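(* For every pair $(\Gamma,\Delta)$ of sets of $\mathcal{L}$-formulas, $(\Gamma,\Delta)$ is consistent (with respect to the axiom system $\mathbb{ICK}$) if and only if $(\Gamma,\Delta)$ is satisfiable (in some pointed Chellas model). In particular, for every $\phi\in\mathcal{L}$, $\phi$ is a theorem of $\mathbb{ICK}$ if and only if $\phi\in\mathsf{IntCK}$.
   Context: The language $\mathcal{L}$ is built from a countably infinite set $Var$ of propositional variables and constants $\top,\bot$ using binary connectives $\wedge,\vee,\to$ and two conditional connectives, written $\phi\mathbin{\Box\!\!\to}\psi$ and $\phi\mathbin{\Diamond\!\!\to}\psi$; $\neg\phi:=\phi\to\bot$ and $\phi\leftrightarrow\psi:=(\phi\to\psi)\wedge(\psi\to\phi)$. A (Chellas) model is $\mathcal{M}=(W,\leq,R,V)$ where $W\neq\emptyset$, $\leq$ is a reflexive transitive relation on $W$, $V:Var\to\mathcal{P}(W)$ with each $V(p)$ upward closed under $\leq$, and $R\subseteq W\times\mathcal{P}(W)\times W$; write $R_X(w,v)$ for $(w,X,v)\in R$. For every $X\subseteq W$: (c1) if $w\leq w'$ and $R_X(w,v)$, then there is $v'$ with $R_X(w',v')$ and $v\leq v'$; (c2) if $R_X(w,v)$ and $v\leq v'$, then there is $w'$ with $w\leq w'$ and $R_X(w',v')$. Satisfaction: $\mathcal{M},w\models\top$; $\mathcal{M},w\not\models\bot$; $\mathcal{M},w\models p$ iff $w\in V(p)$; $\wedge,\vee$ pointwise; $\mathcal{M},w\models\psi\to\chi$ iff for all $v\geq w$, $\mathcal{M},v\models\psi$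 implies $\mathcal{M},v\models\chi$; $\mathcal{M},w\models\psi\mathbin{\Box\!\!\to}\chi$ iff for all $v\geq w$ and all $u$ with $R_{\|\psi\|}(v,u)$, $\mathcal{M},u\models\chi$; $\mathcal{M},w\models\psi\mathbin{\Diamond\!\!\to}\chi$ iff there is $u$ with $R_{\|\psi\|}(w,u)$ and $\mathcal{M},u\models\chi$; here $\|\psi\|=\{w\in W\mid \mathcal{M},w\models\psi\}$. A pair $(\Gamma,\Delta)$ of sets of formulas is satisfiable iff some $(\mathcal{M},w)$ satisfies every member of $\Gamma$ and no member of $\Delta$. $\mathsf{IntCK}$ is the set of formulas true at every pointed model. The Hilbert system $\mathbb{ICK}$ has axioms: (A0) all $\mathcal{L}$-instances of a complete axiomatization of intuitionistic propositional logic; (A1) $((\phi\mathbin{\Box\!\!\to}\psi)\wedge(\phi\mathbin{\Box\!\!\to}\chi))\leftrightarrow(\phi\mathbin{\Box\!\!\to}(\psi\wedge\chi))$; (A2) $((\phi\mathbin{\Diamond\!\!\to}\psi)\wedge(\phi\mathbin{\Box\!\!\to}\chi))\to(\phi\mathbin{\Diamond\!\!\to}(\psi\wedge\chi))$; (A3) $(\phi\mathbin{\Diamond\!\!\to}(\psi\vee\chi))\leftrightarrow((\phi\mathbin{\Diamond\!\!\to}\psi)\vee(\phi\mathbin{\Diamond\!\!\to}\chi))$; (A4) $((\phi\mathbin{\Diamond\!\!\to}\psi)\to(\phi\mathbin{\Box\!\!\to}\chi))\to(\phi\mathbin{\Box\!\!\to}(\psi\to\chi))$; (A5) $\phi\mathbin{\Box\!\!\to}\top$;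 (A6) $\neg(\phi\mathbin{\Diamond\!\!\to}\bot)$; and rules: modus ponens; from $\phi\leftrightarrow\psi$ infer $(\phi\mathbin{\Box\!\!\to}\chi)\leftrightarrow(\psi\mathbin{\Box\!\!\to}\chi)$; from $\phi\leftrightarrow\psi$ infer $(\chi\mathbin{\Box\!\!\to}\phi)\leftrightarrow(\chi\mathbin{\Box\!\!\to}\psi)$; and the same two rules with $\mathbin{\Diamond\!\!\to}$ in place of $\mathbin{\Box\!\!\to}$. Theorems are formulas with a proof. $\Gamma\vdash\psi$ iff there is a finite sequence ending in $\psi$ each member of which is in $\Gamma$, a theorem, or obtained from earlier members by modus ponens. A pair $(\Gamma,\Delta)$ is consistent iff there is no finite $\Delta'\subseteq\Delta$ with $\Gamma\vdash\bigvee\Delta'$ (where $\bigvee\emptyset=\bot$). *)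

theory Defs
  imports Main
begin

datatype fm =
    Var nat
  | Top ("\<^bold>\<top>")
  | Bot ("\<^bold>\<bottom>")
  | And fm fm (infixr "\<^bold>\<and>" 60)
  | Or fm fm (infixr "\<^bold>\<or>" 59)
  | Imp fm fm (infixr "\<^bold>\<longrightarrow>" 57)
  | CBox fm fm (infixr "\<box>\<rightarrow>" 58)
  | CDia fm fm (infixr "\<diamond>\<rightarrow>" 58)

abbreviation Neg :: "fm \<Rightarrow> fm" ("\<^bold>\<not> _" [61] 61) where
  "\<^bold>\<not> \<phi> \<equiv> \<phi> \<^bold>\<longrightarrow> \<^bold>\<bottom>"

abbreviation Iff :: "fm \<Rightarrow> fm \<Rightarrow> fm" (infix "\<^bold>\<longleftrightarrow>" 56) where
  "\<phi> \<^bold>\<longleftrightarrow> \<psi> \<equiv> (\<phi> \<^bold>\<longrightarrow> \<psi>) \<^bold>\<and> (\<psi> \<^bold>\<longrightarrow> \<phi>)"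

text \<open>
  The set of worlds is an explicit carrier, so a model over the type \<open>'w\<close> may have any nonempty
  subset of \<open>'w\<close> as its set of worlds. A triple \<open>(w, X, v) \<in> rel M\<close> stands for \<open>R\<^sub>X(w, v)\<close>.
\<close>

record 'w chellas =
  worlds :: "'w set"
  le :: "('w \<times> 'w) set"
  rel :: "('w \<times> 'w set \<times> 'w) set"
  val :: "nat \<Rightarrow> 'w set"

locale chellas_model =
  fixes M :: "'w chellas"
  assumes worlds_nonempty: "worlds M \<noteq> {}"
    and le_preorder: "preorder_on (worlds M) (le M)"
    and rel_subset: "rel M \<subseteq> worlds M \<times> Pow (worlds M) \<times> worlds M"
    and val_subset: "val M p \<subseteq> worlds M"
    and val_upward: "\<lbrakk>w \<in> val M p; (w, v) \<in> le M\<rbrakk> \<Longrightarrow> v \<in> val M p"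
    and c1: "\<lbrakk>X \<subseteq> worlds M; (w, w') \<in> le M; (w, X, v) \<in> rel M\<rbrakk>
      \<Longrightarrow> \<exists>v'. (w', X, v') \<in> rel M \<and> (v, v') \<in> le M"
    and c2: "\<lbrakk>X \<subseteq> worlds M; (w, X, v) \<in> rel M; (v, v') \<in> le M\<rbrakk>
      \<Longrightarrow> \<exists>w'. (w, w') \<in> le M \<and> (w', X, v') \<in> rel M"

primrec sat :: "'w chellas \<Rightarrow> 'w \<Rightarrow> fm \<Rightarrow> bool" where
  "sat M w (Var p) \<longleftrightarrow> w \<in> val M p"
| "sat M w \<^bold>\<top> \<longleftrightarrow> True"
| "sat M w \<^bold>\<bottom> \<longleftrightarrow> False"
| "sat M w (\<psi> \<^bold>\<and> \<chi>) \<longleftrightarrow> sat M w \<psi> \<and> sat M w \<chi>"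
| "sat M w (\<psi> \<^bold>\<or> \<chi>) \<longleftrightarrow> sat M w \<psi> \<or> sat M w \<chi>"
| "sat M w (\<psi> \<^bold>\<longrightarrow> \<chi>) \<longleftrightarrow> (\<forall>v. (w, v) \<in> le M \<longrightarrow> sat M v \<psi> \<longrightarrow> sat M v \<chi>)"
| "sat M w (\<psi> \<box>\<rightarrow> \<chi>) \<longleftrightarrow>
     (\<forall>v u. (w, v) \<in> le M \<longrightarrow> (v, {x \<in> worlds M. sat M x \<psi>}, u) \<in> rel M \<longrightarrow> sat M u \<chi>)"
| "sat M w (\<psi> \<diamond>\<rightarrow> \<chi>) \<longleftrightarrow>
     (\<exists>u. (w, {x \<in> worlds M. sat M x \<psi>}, u) \<in> rel M \<and> sat M u \<chi>)"

text \<open>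
  HOL cannot quantify over types inside a formula, so the type in which the worlds live is an
  explicit parameter of the two semantic notions.
\<close>

definition satisfiable :: "'w itself \<Rightarrow> fm set \<Rightarrow> fm set \<Rightarrow> bool" where
  "satisfiable (_ :: 'w itself) \<Gamma> \<Delta> \<longleftrightarrow>
     (\<exists>(M :: 'w chellas) w. chellas_model M \<and> w \<in> worlds M \<and>
        (\<forall>\<phi>\<in>\<Gamma>. sat M w \<phi>) \<and> (\<forall>\<phi>\<in>\<Delta>. \<not> sat M w \<phi>))"

definition IntCK :: "'w itself \<Rightarrow> fm set" where
  "IntCK (_ :: 'w itself) =
     {\<phi>. \<forall>(M :: 'w chellas) w. chellas_model M \<longrightarrow> w \<in> worlds M \<longrightarrow> sat M w \<phi>}"

inductive ICK :: "fm \<Rightarrow> bool" where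
  A0_K: "ICK (\<phi> \<^bold>\<longrightarrow> \<psi> \<^bold>\<longrightarrow> \<phi>)"
| A0_S: "ICK ((\<phi> \<^bold>\<longrightarrow> \<psi> \<^bold>\<longrightarrow> \<chi>) \<^bold>\<longrightarrow> (\<phi> \<^bold>\<longrightarrow> \<psi>) \<^bold>\<longrightarrow> \<phi> \<^bold>\<longrightarrow> \<chi>)"
| A0_AndE1: "ICK (\<phi> \<^bold>\<and> \<psi> \<^bold>\<longrightarrow> \<phi>)"
| A0_AndE2: "ICK (\<phi> \<^bold>\<and> \<psi> \<^bold>\<longrightarrow> \<psi>)"
| A0_AndI: "ICK (\<phi> \<^bold>\<longrightarrow> \<psi> \<^bold>\<longrightarrow> \<phi> \<^bold>\<and> \<psi>)"
| A0_OrI1: "ICK (\<phi> \<^bold>\<longrightarrow> \<phi> \<^bold>\<or> \<psi>)"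
| A0_OrI2: "ICK (\<psi> \<^bold>\<longrightarrow> \<phi> \<^bold>\<or> \<psi>)"
| A0_OrE: "ICK ((\<phi> \<^bold>\<longrightarrow> \<chi>) \<^bold>\<longrightarrow> (\<psi> \<^bold>\<longrightarrow> \<chi>) \<^bold>\<longrightarrow> \<phi> \<^bold>\<or> \<psi> \<^bold>\<longrightarrow> \<chi>)"
| A0_Bot: "ICK (\<^bold>\<bottom> \<^bold>\<longrightarrow> \<phi>)"
| A0_Top: "ICK \<^bold>\<top>"
| A1: "ICK (((\<phi> \<box>\<rightarrow> \<psi>) \<^bold>\<and> (\<phi> \<box>\<rightarrow> \<chi>)) \<^bold>\<longleftrightarrow> (\<phi> \<box>\<rightarrow> (\<psi> \<^bold>\<and> \<chi>)))"
| A2: "ICK (((\<phi> \<diamond>\<rightarrow> \<psi>) \<^bold>\<and> (\<phi> \<box>\<rightarrow> \<chi>)) \<^bold>\<longrightarrow> (\<phi> \<diamond>\<rightarrow> (\<psi> \<^bold>\<and> \<chi>)))"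
| A3: "ICK ((\<phi> \<diamond>\<rightarrow> (\<psi> \<^bold>\<or> \<chi>)) \<^bold>\<longleftrightarrow> ((\<phi> \<diamond>\<rightarrow> \<psi>) \<^bold>\<or> (\<phi> \<diamond>\<rightarrow> \<chi>)))"
| A4: "ICK (((\<phi> \<diamond>\<rightarrow> \<psi>) \<^bold>\<longrightarrow> (\<phi> \<box>\<rightarrow> \<chi>)) \<^bold>\<longrightarrow> (\<phi> \<box>\<rightarrow> (\<psi> \<^bold>\<longrightarrow> \<chi>)))"
| A5: "ICK (\<phi> \<box>\<rightarrow> \<^bold>\<top>)"
| A6: "ICK (\<^bold>\<not> (\<phi> \<diamond>\<rightarrow> \<^bold>\<bottom>))"
| MP: "ICK \<phi> \<Longrightarrow> ICK (\<phi> \<^bold>\<longrightarrow> \<psi>) \<Longrightarrow> ICK \<psi>"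
| RA_Box: "ICK (\<phi> \<^bold>\<longleftrightarrow> \<psi>) \<Longrightarrow> ICK ((\<phi> \<box>\<rightarrow> \<chi>) \<^bold>\<longleftrightarrow> (\<psi> \<box>\<rightarrow> \<chi>))"
| RC_Box: "ICK (\<phi> \<^bold>\<longleftrightarrow> \<psi>) \<Longrightarrow> ICK ((\<chi> \<box>\<rightarrow> \<phi>) \<^bold>\<longleftrightarrow> (\<chi> \<box>\<rightarrow> \<psi>))"
| RA_Dia: "ICK (\<phi> \<^bold>\<longleftrightarrow> \<psi>) \<Longrightarrow> ICK ((\<phi> \<diamond>\<rightarrow> \<chi>) \<^bold>\<longleftrightarrow> (\<psi> \<diamond>\<rightarrow> \<chi>))"
| RC_Dia: "ICK (\<phi> \<^bold>\<longleftrightarrow> \<psi>) \<Longrightarrow> ICK ((\<chi> \<diamond>\<rightarrow> \<phi>) \<^bold>\<longleftrightarrow> (\<chi> \<diamond>\<rightarrow> \<psi>))"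

definition derives :: "fm set \<Rightarrow> fm \<Rightarrow> bool" (infix "\<turnstile>" 50) where
  "\<Gamma> \<turnstile> \<psi> \<longleftrightarrow>
     (\<exists>\<pi>. \<pi> \<noteq> [] \<and> last \<pi> = \<psi> \<and>
        (\<forall>i < length \<pi>. \<pi> ! i \<in> \<Gamma> \<or> ICK (\<pi> ! i) \<or>
           (\<exists>j < i. \<exists>k < i. \<pi> ! k = (\<pi> ! j \<^bold>\<longrightarrow> \<pi> ! i))))"

fun Disj :: "fm list \<Rightarrow> fm" where
  "Disj [] = \<^bold>\<bottom>"
| "Disj [\<phi>] = \<phi>"
| "Disj (\<phi> # \<psi> # \<phi>s) = \<phi> \<^bold>\<or> Disj (\<psi> # \<phi>s)"

text \<open>
  A finite subset of \<open>\<Delta>\<close> is given by a list enumerating it. All enumerations are admitted; the order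
  and repetitions do not matter, since the resulting disjunctions are provably equivalent.
\<close>

definition consistent :: "fm set \<Rightarrow> fm set \<Rightarrow> bool" where
  "consistent \<Gamma> \<Delta> \<longleftrightarrow> \<not> (\<exists>\<delta>s. set \<delta>s \<subseteq> \<Delta> \<and> \<Gamma> \<turnstile> Disj \<delta>s)"

end

theory Submission
  imports Defs
begin

text \<open>
  Soundness is an induction on derivations; (c1) makes truth persistent and (c2) validates A4.
  For completeness, the worlds of the canonical model are the prime theories ordered by inclusion,
  and \<open>R\<^sub>X(w, v)\<close> holds iff \<open>X\<close> is the set of prime theories containing some \<open>\<phi>\<close> such that
  \<open>\<phi> \<box>\<rightarrow> \<psi> \<in> w\<close> implies \<open>\<psi> \<in> v\<close> and \<open>\<psi> \<in> v\<close> implies \<open>\<phi> \<diamond>\<rightarrow> \<psi> \<in> w\<close>. Two extension arguments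
  supply all witnesses: by A4, if only the first condition holds then \<open>w\<close> can be enlarged to satisfy
  both; by A2, A3 and A6, a set all of whose finite conjunctions are possible at \<open>w\<close> can be enlarged
  to a successor of \<open>w\<close>.
\<close>

section \<open>Derivability\<close>

lemma derives_assm: "\<phi> \<in> \<Gamma> \<Longrightarrow> \<Gamma> \<turnstile> \<phi>"
  unfolding derives_def by (rule exI[of _ "[\<phi>]"]) simp

lemma derives_ICK: "ICK \<phi> \<Longrightarrow> \<Gamma> \<turnstile> \<phi>"
  unfolding derives_def by (rule exI[of _ "[\<phi>]"]) simp

text \<open>Concatenating the two proof sequences and appending \<open>\<psi>\<close> gives a proof.
  References inside the second sequence are shifted by the length of the first.\<close>

lemma derives_mp:
  assumes "\<Gamma> \<turnstile> \<phi> \<^bold>\<longrightarrow> \<psi>" and "\<Gamma> \<turnstile> \<phi>"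
  shows "\<Gamma> \<turnstile> \<psi>"
proof -
  let ?ok = "\<lambda>\<pi> i. \<pi> ! i \<in> \<Gamma> \<or> ICK (\<pi> ! i) \<or> (\<exists>j < i. \<exists>k < i. \<pi> ! k = (\<pi> ! j \<^bold>\<longrightarrow> \<pi> ! i))"
  obtain \<pi> where \<pi>: "\<pi> \<noteq> []" "last \<pi> = (\<phi> \<^bold>\<longrightarrow> \<psi>)" "\<And>i. i < length \<pi> \<Longrightarrow> ?ok \<pi> i"
    using assms(1) unfolding derives_def by blast
  obtain \<rho> where \<rho>: "\<rho> \<noteq> []" "last \<rho> = \<phi>" "\<And>i. i < length \<rho> \<Longrightarrow> ?ok \<rho> i"
    using assms(2) unfolding derives_def by blast
  let ?\<sigma> = "\<pi> @ \<rho> @ [\<psi>]"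
  have "?ok ?\<sigma> i" if i: "i < length ?\<sigma>" for i
  proof -
    consider (1) "i < length \<pi>" | (2) j where "i = length \<pi> + j" "j < length \<rho>"
      | (3) "i = length \<pi> + length \<rho>"
      using i by (cases "i < length \<pi>"; cases "i < length \<pi> + length \<rho>")
        (auto dest!: le_Suc_ex simp: not_less)
    then show ?thesis
    proof cases
      case 1
      show ?thesis
        using \<pi>(3)[OF 1] 1 by (smt (verit) nth_append order.strict_trans)
    next
      case 2
      have eq: "?\<sigma> ! (length \<pi> + l) = \<rho> ! l" if "l < length \<rho>" for l
        using that by (simp add: nth_append)
      from \<rho>(3)[OF 2(2)] show ?thesis
      proof (elim disjE exE conjE)
        fix k l assume "k < j" "l < j" "\<rho> ! l = (\<rho> ! k \<^bold>\<longrightarrow> \<rho> ! j)"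
        then have "?\<sigma> ! (length \<pi> + l) = (?\<sigma> ! (length \<pi> + k) \<^bold>\<longrightarrow> ?\<sigma> ! i)"
          using 2 eq by simp
        then show ?thesis
          using \<open>k < j\<close> \<open>l < j\<close> 2(1) by (metis nat_add_left_cancel_less)
      qed (use 2 eq in auto)
    next
      case 3
      \<comment> \<open>The appended formula follows by modus ponens from the last entries of the
        two sequences, which are located here.\<close>
      have "?\<sigma> ! (length \<pi> - 1) = (\<phi> \<^bold>\<longrightarrow> \<psi>)"
        using \<pi>(1,2) by (simp add: nth_append last_conv_nth)
      moreover have "?\<sigma> ! (length \<pi> + (length \<rho> - 1)) = \<phi>"
        using \<rho>(1,2) by (simp add: nth_append last_conv_nth)
      moreover have "?\<sigma> ! i = \<psi>"
        using 3 by (simp add: nth_append)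
      moreover have "length \<pi> - 1 < i" "length \<pi> + (length \<rho> - 1) < i"
        using 3 \<pi>(1) \<rho>(1) by (auto simp: neq_Nil_conv)
      ultimately show ?thesis by metis
    qed
  qed
  then show ?thesis
    unfolding derives_def by (intro exI[of _ ?\<sigma>]) simp
qed

text \<open>Strong induction on the position in a proof sequence. From here on derivability is
  handled by this rule, without mention of sequences.\<close>

lemma derives_induct [consumes 1, case_names assm ax mp]:
  assumes "\<Gamma> \<turnstile> \<psi>"
    and assm: "\<And>\<phi>. \<phi> \<in> \<Gamma> \<Longrightarrow> P \<phi>"
    and ax: "\<And>\<phi>. ICK \<phi> \<Longrightarrow> P \<phi>"
    and mp: "\<And>\<phi> \<chi>. P (\<phi> \<^bold>\<longrightarrow> \<chi>) \<Longrightarrow> P \<phi> \<Longrightarrow> P \<chi>"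
  shows "P \<psi>"
proof -
  obtain \<pi> where \<pi>: "\<pi> \<noteq> []" "last \<pi> = \<psi>"
    "\<And>i. i < length \<pi> \<Longrightarrow> \<pi> ! i \<in> \<Gamma> \<or> ICK (\<pi> ! i) \<or>
       (\<exists>j < i. \<exists>k < i. \<pi> ! k = (\<pi> ! j \<^bold>\<longrightarrow> \<pi> ! i))"
    using assms(1) unfolding derives_def by blast
  have "P (\<pi> ! i)" if "i < length \<pi>" for i
    using that
  proof (induction i rule: less_induct)
    case (less i)
    then show ?case
      using \<pi>(3)[OF less.prems] assm ax mp by (metis order.strict_trans)
  qed
  then show ?thesis
    using \<pi>(1,2) by (metis diff_less last_conv_nth length_greater_0_conv zero_less_one)
qed

lemma derives_cut:
  assumes "\<Gamma> \<turnstile> \<psi>" and "\<And>\<phi>. \<phi> \<in> \<Gamma> \<Longrightarrow> \<Gamma>' \<turnstile> \<phi>"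
  shows "\<Gamma>' \<turnstile> \<psi>"
  using assms(1) by (induction rule: derives_induct) (auto intro: assms(2) derives_ICK derives_mp)

lemma derives_mono: "\<Gamma> \<turnstile> \<psi> \<Longrightarrow> \<Gamma> \<subseteq> \<Gamma>' \<Longrightarrow> \<Gamma>' \<turnstile> \<psi>"
  by (erule derives_cut) (auto intro: derives_assm)

lemma ICK_iff_derives: "ICK \<phi> \<longleftrightarrow> {} \<turnstile> \<phi>"
proof
  assume "{} \<turnstile> \<phi>"
  then show "ICK \<phi>"
    by (induction rule: derives_induct) (auto intro: MP)
qed (rule derives_ICK)

section \<open>The deduction theorem and rules for the connectives\<close>

lemma ICK_self_imp: "ICK (\<phi> \<^bold>\<longrightarrow> \<phi>)"
  using A0_K A0_S MP by blast

text \<open>Deduction theorem. Only modus ponens acts on premises, while the congruence rules act on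
  theorems alone, so the K and S axioms suffice.\<close>

lemma derives_impI:
  assumes "insert \<phi> \<Gamma> \<turnstile> \<psi>"
  shows "\<Gamma> \<turnstile> \<phi> \<^bold>\<longrightarrow> \<psi>"
  using assms
proof (induction rule: derives_induct)
  case (assm \<chi>)
  then show ?case
    by (metis A0_K ICK_self_imp derives_ICK derives_assm derives_mp insertE)
next
  case (ax \<chi>)
  then show ?case by (metis A0_K MP derives_ICK)
next
  case (mp \<chi> \<theta>)
  then show ?case by (metis A0_S derives_ICK derives_mp)
qed

lemma derives_imp_iff: "\<Gamma> \<turnstile> \<phi> \<^bold>\<longrightarrow> \<psi> \<longleftrightarrow> insert \<phi> \<Gamma> \<turnstile> \<psi>"
  by (meson derives_assm derives_impI derives_mono derives_mp insertI1 subset_insertI)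

lemma derives_imp_trans: "\<Gamma> \<turnstile> \<phi> \<^bold>\<longrightarrow> \<psi> \<Longrightarrow> \<Gamma> \<turnstile> \<psi> \<^bold>\<longrightarrow> \<chi> \<Longrightarrow> \<Gamma> \<turnstile> \<phi> \<^bold>\<longrightarrow> \<chi>"
  by (meson derives_imp_iff derives_mono derives_mp subset_insertI)

lemma derives_and_iff: "\<Gamma> \<turnstile> \<phi> \<^bold>\<and> \<psi> \<longleftrightarrow> \<Gamma> \<turnstile> \<phi> \<and> \<Gamma> \<turnstile> \<psi>"
  by (meson A0_AndE1 A0_AndE2 A0_AndI derives_ICK derives_mp)

lemma derives_insert_and: "insert (\<phi> \<^bold>\<and> \<psi>) \<Gamma> \<turnstile> \<chi> \<longleftrightarrow> insert \<phi> (insert \<psi> \<Gamma>) \<turnstile> \<chi>"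
proof
  assume "insert (\<phi> \<^bold>\<and> \<psi>) \<Gamma> \<turnstile> \<chi>"
  then show "insert \<phi> (insert \<psi> \<Gamma>) \<turnstile> \<chi>"
    by (rule derives_cut) (auto simp: derives_and_iff intro: derives_assm)
next
  have *: "insert (\<phi> \<^bold>\<and> \<psi>) \<Gamma> \<turnstile> \<phi>" "insert (\<phi> \<^bold>\<and> \<psi>) \<Gamma> \<turnstile> \<psi>"
    using derives_assm[of "\<phi> \<^bold>\<and> \<psi>" "insert (\<phi> \<^bold>\<and> \<psi>) \<Gamma>"] by (simp_all add: derives_and_iff)
  assume "insert \<phi> (insert \<psi> \<Gamma>) \<turnstile> \<chi>"
  then show "insert (\<phi> \<^bold>\<and> \<psi>) \<Gamma> \<turnstile> \<chi>"
    by (rule derives_cut) (auto simp: * intro: derives_assm)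
qed

lemma derives_orI1: "\<Gamma> \<turnstile> \<phi> \<Longrightarrow> \<Gamma> \<turnstile> \<phi> \<^bold>\<or> \<psi>"
  and derives_orI2: "\<Gamma> \<turnstile> \<psi> \<Longrightarrow> \<Gamma> \<turnstile> \<phi> \<^bold>\<or> \<psi>"
  by (meson A0_OrI1 A0_OrI2 derives_ICK derives_mp)+

lemma derives_insert_or: "insert (\<phi> \<^bold>\<or> \<psi>) \<Gamma> \<turnstile> \<chi> \<longleftrightarrow> insert \<phi> \<Gamma> \<turnstile> \<chi> \<and> insert \<psi> \<Gamma> \<turnstile> \<chi>"
proof
  assume L: "insert (\<phi> \<^bold>\<or> \<psi>) \<Gamma> \<turnstile> \<chi>"
  show "insert \<phi> \<Gamma> \<turnstile> \<chi> \<and> insert \<psi> \<Gamma> \<turnstile> \<chi>"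
    by (intro conjI; rule derives_cut[OF L]) (auto intro: derives_orI1 derives_orI2 derives_assm)
next
  assume "insert \<phi> \<Gamma> \<turnstile> \<chi> \<and> insert \<psi> \<Gamma> \<turnstile> \<chi>"
  then show "insert (\<phi> \<^bold>\<or> \<psi>) \<Gamma> \<turnstile> \<chi>"
    by (metis A0_OrE derives_ICK derives_imp_iff derives_mp)
qed

lemma derives_insert_bot: "insert \<^bold>\<bottom> \<Gamma> \<turnstile> \<chi>"
  using A0_Bot derives_ICK derives_imp_iff by blast

lemma ICK_iff_imps: "ICK (\<phi> \<^bold>\<longleftrightarrow> \<psi>) \<longleftrightarrow> ICK (\<phi> \<^bold>\<longrightarrow> \<psi>) \<and> ICK (\<psi> \<^bold>\<longrightarrow> \<phi>)"
  by (simp add: ICK_iff_derives derives_and_iff)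

lemma derives_Disj: "\<delta> \<in> set \<delta>s \<Longrightarrow> \<Gamma> \<turnstile> \<delta> \<Longrightarrow> \<Gamma> \<turnstile> Disj \<delta>s"
  by (induction \<delta>s rule: Disj.induct) (auto intro: derives_orI1 derives_orI2)

lemma derives_insert_Disj: "insert (Disj \<delta>s) \<Gamma> \<turnstile> \<chi> \<longleftrightarrow> (\<forall>\<delta>\<in>set \<delta>s. insert \<delta> \<Gamma> \<turnstile> \<chi>)"
  by (induction \<delta>s rule: Disj.induct) (auto simp: derives_insert_bot derives_insert_or)

text \<open>Derivability of a disjunction depends only on the set of its members and is monotone in
  it, so order and repetition in the enumerating lists are harmless.\<close>

lemma derives_Disj_mono:
  assumes "\<Gamma> \<turnstile> Disj \<delta>s" and "set \<delta>s \<subseteq> set \<epsilon>s"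
  shows "\<Gamma> \<turnstile> Disj \<epsilon>s"
proof -
  have "insert (Disj \<delta>s) \<Gamma> \<turnstile> Disj \<epsilon>s"
    unfolding derives_insert_Disj using assms(2) by (auto intro: derives_Disj derives_assm)
  then show ?thesis
    using assms(1) derives_imp_iff derives_mp by blast
qed

section \<open>Directed sets of premises\<close>

text \<open>Compactness along a chain: at each modus ponens, the larger of the two chain members
  derives both premises.\<close>

lemma derives_chain_union:
  assumes "\<Union>C \<turnstile> \<psi>" and "C \<noteq> {}" and chain: "\<And>A B. A \<in> C \<Longrightarrow> B \<in> C \<Longrightarrow> A \<subseteq> B \<or> B \<subseteq> A"
  shows "\<exists>\<Gamma>\<in>C. \<Gamma> \<turnstile> \<psi>"
  using assms(1)
proof (induction rule: derives_induct)
  case (assm \<phi>)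
  then show ?case by (auto intro: derives_assm)
next
  case (ax \<phi>)
  then show ?case using \<open>C \<noteq> {}\<close> by (auto intro: derives_ICK)
next
  case (mp \<phi> \<chi>)
  then obtain A B where "A \<in> C" "B \<in> C" "A \<turnstile> \<phi> \<^bold>\<longrightarrow> \<chi>" "B \<turnstile> \<phi>"
    by blast
  then show ?case
    using chain[of A B] by (meson derives_mono derives_mp)
qed

text \<open>Compactness with a single witness: since \<open>S\<close> is directed under provable
  implication, one member of it can stand for all members used in the derivation. Directedness is
  more flexible than closure under conjunction, which fails for the sets of diamond formulas to
  which this is applied later.\<close>

lemma derives_directed:
  assumes "S \<union> \<Gamma> \<turnstile> \<psi>" and "S \<noteq> {}"
    and directed: "\<And>\<alpha> \<beta>. \<alpha> \<in> S \<Longrightarrow> \<beta> \<in> S \<Longrightarrow> \<exists>\<gamma>\<in>S. ICK (\<gamma> \<^bold>\<longrightarrow> \<alpha>) \<and> ICK (\<gamma> \<^bold>\<longrightarrow> \<beta>)"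
  shows "\<exists>\<alpha>\<in>S. \<Gamma> \<turnstile> \<alpha> \<^bold>\<longrightarrow> \<psi>"
  using assms(1)
proof (induction rule: derives_induct)
  case (assm \<phi>)
  then show ?case
    using \<open>S \<noteq> {}\<close> ICK_self_imp
    by (metis UnE all_not_in_conv derives_ICK derives_assm derives_impI insertCI)
next
  case (ax \<phi>)
  then show ?case
    using \<open>S \<noteq> {}\<close> by (metis all_not_in_conv derives_ICK derives_impI)
next
  case (mp \<phi> \<chi>)
  then obtain \<alpha> \<beta> where \<alpha>\<beta>: "\<alpha> \<in> S" "\<beta> \<in> S" "\<Gamma> \<turnstile> \<alpha> \<^bold>\<longrightarrow> \<phi> \<^bold>\<longrightarrow> \<chi>" "\<Gamma> \<turnstile> \<beta> \<^bold>\<longrightarrow> \<phi>"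
    by blast
  obtain \<gamma> where \<gamma>: "\<gamma> \<in> S" "ICK (\<gamma> \<^bold>\<longrightarrow> \<alpha>)" "ICK (\<gamma> \<^bold>\<longrightarrow> \<beta>)"
    using directed[OF \<alpha>\<beta>(1,2)] by blast
  have "insert \<gamma> \<Gamma> \<turnstile> \<alpha>" "insert \<gamma> \<Gamma> \<turnstile> \<beta>"
    using \<gamma>(2,3) derives_ICK derives_imp_iff by blast+
  moreover have "insert \<gamma> \<Gamma> \<turnstile> \<alpha> \<^bold>\<longrightarrow> \<phi> \<^bold>\<longrightarrow> \<chi>" "insert \<gamma> \<Gamma> \<turnstile> \<beta> \<^bold>\<longrightarrow> \<phi>"
    using \<alpha>\<beta>(3,4) by (auto elim: derives_mono)
  ultimately show ?case
    using \<gamma>(1) derives_impI derives_mp by blast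
qed

section \<open>Prime theories\<close>

definition prime_theory :: "fm set \<Rightarrow> bool" where
  "prime_theory T \<longleftrightarrow> (\<forall>\<phi>. T \<turnstile> \<phi> \<longrightarrow> \<phi> \<in> T) \<and> \<^bold>\<bottom> \<notin> T \<and>
     (\<forall>\<phi> \<psi>. \<phi> \<^bold>\<or> \<psi> \<in> T \<longrightarrow> \<phi> \<in> T \<or> \<psi> \<in> T)"

lemma prime_closed: "prime_theory T \<Longrightarrow> T \<turnstile> \<phi> \<Longrightarrow> \<phi> \<in> T"
  and prime_bot: "prime_theory T \<Longrightarrow> \<^bold>\<bottom> \<notin> T"
  and prime_orD: "prime_theory T \<Longrightarrow> \<phi> \<^bold>\<or> \<psi> \<in> T \<Longrightarrow> \<phi> \<in> T \<or> \<psi> \<in> T"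
  unfolding prime_theory_def by blast+

lemma prime_ICK: "prime_theory T \<Longrightarrow> ICK \<phi> \<Longrightarrow> \<phi> \<in> T"
  by (simp add: derives_ICK prime_closed)

lemma prime_mp: "prime_theory T \<Longrightarrow> \<phi> \<^bold>\<longrightarrow> \<psi> \<in> T \<Longrightarrow> \<phi> \<in> T \<Longrightarrow> \<psi> \<in> T"
  by (meson derives_assm derives_mp prime_closed)

lemma prime_ICK_mp: "prime_theory T \<Longrightarrow> ICK (\<phi> \<^bold>\<longrightarrow> \<psi>) \<Longrightarrow> \<phi> \<in> T \<Longrightarrow> \<psi> \<in> T"
  by (meson prime_ICK prime_mp)

lemma prime_derives_iff: "prime_theory T \<Longrightarrow> T \<turnstile> \<phi> \<longleftrightarrow> \<phi> \<in> T"
  by (meson derives_assm prime_closed)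

lemma prime_and_iff: "prime_theory T \<Longrightarrow> \<phi> \<^bold>\<and> \<psi> \<in> T \<longleftrightarrow> \<phi> \<in> T \<and> \<psi> \<in> T"
  using derives_and_iff[of T] by (simp add: prime_derives_iff)

lemma prime_or_iff: "prime_theory T \<Longrightarrow> \<phi> \<^bold>\<or> \<psi> \<in> T \<longleftrightarrow> \<phi> \<in> T \<or> \<psi> \<in> T"
  by (meson A0_OrI1 A0_OrI2 prime_ICK_mp prime_orD)

text \<open>A disjunction of copies of \<open>\<phi>\<close>, or the empty one, derives
  \<open>\<phi>\<close>.\<close>

lemma consistent_single_iff: "consistent \<Gamma> {\<phi>} \<longleftrightarrow> \<not> \<Gamma> \<turnstile> \<phi>"
proof -
  have "\<Gamma> \<turnstile> \<phi>" if "set \<delta>s \<subseteq> {\<phi>}" "\<Gamma> \<turnstile> Disj \<delta>s" for \<delta>s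
    using derives_Disj_mono[OF that(2), of "[\<phi>]"] that(1) by simp
  moreover have "\<exists>\<delta>s. set \<delta>s \<subseteq> {\<phi>} \<and> \<Gamma> \<turnstile> Disj \<delta>s" if "\<Gamma> \<turnstile> \<phi>"
    using that by (intro exI[of _ "[\<phi>]"]) simp
  ultimately show ?thesis
    unfolding consistent_def by blast
qed

text \<open>Lindenbaum's lemma for pairs: by Zorn, take an extension of \<open>\<Gamma>\<close> that
  is maximal among those consistent with \<open>\<Delta>\<close>; maximality makes it a prime
  theory.\<close>

lemma prime_extension:
  assumes "consistent \<Gamma> \<Delta>"
  obtains T where "prime_theory T" "\<Gamma> \<subseteq> T" "T \<inter> \<Delta> = {}"
proof -
  let ?A = "{T. \<Gamma> \<subseteq> T \<and> consistent T \<Delta>}"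
  have "\<exists>T\<in>?A. \<forall>X\<in>?A. T \<subseteq> X \<longrightarrow> X = T"
  proof (rule subset_Zorn_nonempty)
    fix C assume C: "C \<noteq> {}" "subset.chain ?A C"
    then have ch: "A \<subseteq> B \<or> B \<subseteq> A" if "A \<in> C" "B \<in> C" for A B
      using that unfolding subset_chain_def by blast
    have CA: "C \<subseteq> ?A"
      using C(2) unfolding subset_chain_def by blast
    have "consistent (\<Union>C) \<Delta>"
      unfolding consistent_def
    proof
      assume "\<exists>\<delta>s. set \<delta>s \<subseteq> \<Delta> \<and> \<Union>C \<turnstile> Disj \<delta>s"
      then obtain \<delta>s where "set \<delta>s \<subseteq> \<Delta>" "\<Union>C \<turnstile> Disj \<delta>s" by blast
      then show False
        using derives_chain_union[OF _ C(1) ch] CA unfolding consistent_def by blast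
    qed
    then show "\<Union>C \<in> ?A"
      using CA C(1) by blast
  qed (use assms in blast)
  then obtain T where T: "\<Gamma> \<subseteq> T" "consistent T \<Delta>"
    and max: "\<And>X. T \<subseteq> X \<Longrightarrow> consistent X \<Delta> \<Longrightarrow> X = T"
    by (smt (verit) mem_Collect_eq subset_trans)
  \<comment> \<open>By maximality, each formula outside \<open>T\<close> leads, together with
    \<open>T\<close>, to a disjunction from \<open>\<Delta>\<close>.\<close>
  have ext: "\<exists>\<delta>s. set \<delta>s \<subseteq> \<Delta> \<and> insert \<phi> T \<turnstile> Disj \<delta>s" if "\<phi> \<notin> T" for \<phi>
    using max[of "insert \<phi> T"] that unfolding consistent_def by blast
  have no: "\<not> T \<turnstile> Disj \<delta>s" if "set \<delta>s \<subseteq> \<Delta>" for \<delta>s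
    using T(2) that unfolding consistent_def by blast
  have closed: "\<phi> \<in> T" if "T \<turnstile> \<phi>" for \<phi>
    using that ext no by (metis derives_imp_iff derives_mp)
  moreover have "\<^bold>\<bottom> \<notin> T"
    \<comment> \<open>The empty disjunction is falsum, so this covers empty \<open>\<Delta>\<close>
      as well.\<close>
    using no[of "[]"] by (auto intro: derives_assm)
  moreover have "\<phi> \<in> T \<or> \<psi> \<in> T" if or: "\<phi> \<^bold>\<or> \<psi> \<in> T" for \<phi> \<psi>
  proof (rule ccontr)
    assume "\<not> (\<phi> \<in> T \<or> \<psi> \<in> T)"
    then obtain \<delta>s \<epsilon>s where *: "set \<delta>s \<subseteq> \<Delta>" "insert \<phi> T \<turnstile> Disj \<delta>s"
      "set \<epsilon>s \<subseteq> \<Delta>" "insert \<psi> T \<turnstile> Disj \<epsilon>s"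
      using ext by meson
    \<comment> \<open>If both disjuncts were missing, the two disjunctions they lead to would merge
      into one that follows from \<open>T\<close>.\<close>
    have "insert (\<phi> \<^bold>\<or> \<psi>) T \<turnstile> Disj (\<delta>s @ \<epsilon>s)"
      unfolding derives_insert_or using *(2,4) by (auto elim: derives_Disj_mono)
    then show False
      using no[of "\<delta>s @ \<epsilon>s"] *(1,3) or by (simp add: insert_absorb)
  qed
  moreover have "T \<inter> \<Delta> = {}"
    using no[of "[_]"] by (auto intro: derives_assm)
  ultimately show thesis
    using that T(1) unfolding prime_theory_def by blast
qed

lemma prime_separation:
  assumes "\<not> \<Gamma> \<turnstile> \<phi>"
  obtains T where "prime_theory T" "\<Gamma> \<subseteq> T" "\<phi> \<notin> T"
  using prime_extension[of \<Gamma> "{\<phi>}"] assms by (auto simp: consistent_single_iff)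

text \<open>The satisfaction clause for implication, with inclusion of prime theories as the order.
  For the direction from right to left, a prime theory separating \<open>\<psi>\<close> from
  \<open>T\<close> together with \<open>\<phi>\<close> would be a counterexample.\<close>

lemma prime_imp_iff:
  assumes "prime_theory T"
  shows "\<phi> \<^bold>\<longrightarrow> \<psi> \<in> T \<longleftrightarrow> (\<forall>U. prime_theory U \<longrightarrow> T \<subseteq> U \<longrightarrow> \<phi> \<in> U \<longrightarrow> \<psi> \<in> U)"
proof
  assume R: "\<forall>U. prime_theory U \<longrightarrow> T \<subseteq> U \<longrightarrow> \<phi> \<in> U \<longrightarrow> \<psi> \<in> U"
  have "insert \<phi> T \<turnstile> \<psi>"
  proof (rule ccontr)
    assume "\<not> insert \<phi> T \<turnstile> \<psi>"
    then obtain U where "prime_theory U" "insert \<phi> T \<subseteq> U" "\<psi> \<notin> U"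
      by (rule prime_separation)
    then show False using R by blast
  qed
  then show "\<phi> \<^bold>\<longrightarrow> \<psi> \<in> T"
    using assms derives_impI prime_closed by blast
qed (use prime_mp in blast)

text \<open>This is the intended truth set of \<open>\<phi>\<close> in the canonical model.\<close>

definition proof_set :: "fm \<Rightarrow> fm set set" where
  "proof_set \<phi> = {T. prime_theory T \<and> \<phi> \<in> T}"

text \<open>A proof set determines its formula up to provable equivalence, so a relation indexed by
  proof sets can be defined through formulas.\<close>

lemma proof_set_subset_imp:
  assumes "proof_set \<phi> \<subseteq> proof_set \<psi>"
  shows "ICK (\<phi> \<^bold>\<longrightarrow> \<psi>)"
proof (rule ccontr)
  assume "\<not> ICK (\<phi> \<^bold>\<longrightarrow> \<psi>)"
  then have "\<not> {\<phi>} \<turnstile> \<psi>"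
    by (simp add: ICK_iff_derives derives_imp_iff)
  then obtain T where "prime_theory T" "{\<phi>} \<subseteq> T" "\<psi> \<notin> T"
    by (rule prime_separation)
  then show False
    using assms unfolding proof_set_def by blast
qed

section \<open>Conditionals in prime theories\<close>

text \<open>The assumption makes \<open>\<psi>\<close> equivalent to its conjunction with
  \<open>\<chi>\<close>; the congruence rule and A1 then distribute the box.\<close>

lemma ICK_box_mono:
  assumes "ICK (\<psi> \<^bold>\<longrightarrow> \<chi>)"
  shows "ICK ((\<phi> \<box>\<rightarrow> \<psi>) \<^bold>\<longrightarrow> (\<phi> \<box>\<rightarrow> \<chi>))"
proof -
  have "{\<psi>} \<turnstile> \<chi>"
    using assms by (simp add: ICK_iff_derives derives_imp_iff)
  then have "ICK (\<psi> \<^bold>\<longleftrightarrow> \<psi> \<^bold>\<and> \<chi>)"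
    by (simp add: ICK_iff_derives derives_and_iff derives_imp_iff derives_insert_and derives_assm)
  from RC_Box[OF this] have "{\<phi> \<box>\<rightarrow> \<psi>} \<turnstile> \<phi> \<box>\<rightarrow> (\<psi> \<^bold>\<and> \<chi>)"
    by (simp add: ICK_iff_derives derives_and_iff derives_imp_iff)
  moreover have "ICK ((\<phi> \<box>\<rightarrow> (\<psi> \<^bold>\<and> \<chi>)) \<^bold>\<longrightarrow> ((\<phi> \<box>\<rightarrow> \<psi>) \<^bold>\<and> (\<phi> \<box>\<rightarrow> \<chi>)))"
    using A1 by (simp add: ICK_iff_imps)
  ultimately have "{\<phi> \<box>\<rightarrow> \<psi>} \<turnstile> (\<phi> \<box>\<rightarrow> \<psi>) \<^bold>\<and> (\<phi> \<box>\<rightarrow> \<chi>)"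
    by (meson derives_ICK derives_mp)
  then show ?thesis
    by (simp add: ICK_iff_derives derives_and_iff derives_imp_iff)
qed

text \<open>Dually to the box case, the disjunction of \<open>\<psi>\<close> and
  \<open>\<chi>\<close> is equivalent to \<open>\<chi>\<close>, and A3 distributes the
  diamond.\<close>

lemma ICK_dia_mono:
  assumes "ICK (\<psi> \<^bold>\<longrightarrow> \<chi>)"
  shows "ICK ((\<phi> \<diamond>\<rightarrow> \<psi>) \<^bold>\<longrightarrow> (\<phi> \<diamond>\<rightarrow> \<chi>))"
proof -
  have "{\<psi>} \<turnstile> \<chi>"
    using assms by (simp add: ICK_iff_derives derives_imp_iff)
  then have "ICK (\<psi> \<^bold>\<or> \<chi> \<^bold>\<longleftrightarrow> \<chi>)"
    by (simp add: ICK_iff_derives derives_and_iff derives_imp_iff derives_insert_or derives_assm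
        derives_orI2)
  from RC_Dia[OF this] have *: "ICK ((\<phi> \<diamond>\<rightarrow> (\<psi> \<^bold>\<or> \<chi>)) \<^bold>\<longrightarrow> (\<phi> \<diamond>\<rightarrow> \<chi>))"
    by (simp add: ICK_iff_imps)
  have "{\<phi> \<diamond>\<rightarrow> \<psi>} \<turnstile> (\<phi> \<diamond>\<rightarrow> \<psi>) \<^bold>\<or> (\<phi> \<diamond>\<rightarrow> \<chi>)"
    by (simp add: derives_assm derives_orI1)
  moreover have "ICK ((\<phi> \<diamond>\<rightarrow> \<psi>) \<^bold>\<or> (\<phi> \<diamond>\<rightarrow> \<chi>) \<^bold>\<longrightarrow> (\<phi> \<diamond>\<rightarrow> (\<psi> \<^bold>\<or> \<chi>)))"
    using A3 by (simp add: ICK_iff_imps)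
  ultimately have "{\<phi> \<diamond>\<rightarrow> \<psi>} \<turnstile> \<phi> \<diamond>\<rightarrow> \<chi>"
    using * by (meson derives_ICK derives_mp)
  then show ?thesis
    by (simp add: ICK_iff_derives derives_imp_iff)
qed

definition boxed :: "fm \<Rightarrow> fm set \<Rightarrow> fm set" where
  "boxed \<phi> w = {\<psi>. \<phi> \<box>\<rightarrow> \<psi> \<in> w}"

definition possible :: "fm \<Rightarrow> fm set \<Rightarrow> fm set" where
  "possible \<phi> w = {\<psi>. \<phi> \<diamond>\<rightarrow> \<psi> \<in> w}"

text \<open>A5 with monotonicity yields necessitation for theorems, and A1 with monotonicity yields
  closure under modus ponens.\<close>

lemma boxed_closed:
  assumes w: "prime_theory w" and "boxed \<phi> w \<turnstile> \<psi>"
  shows "\<psi> \<in> boxed \<phi> w"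
  using assms(2)
proof (induction rule: derives_induct)
  case (ax \<psi>)
  then have "ICK (\<^bold>\<top> \<^bold>\<longrightarrow> \<psi>)"
    using A0_K MP by blast
  then have "ICK (\<phi> \<box>\<rightarrow> \<psi>)"
    using A5 ICK_box_mono MP by blast
  then show ?case
    unfolding boxed_def using w prime_ICK by simp
next
  case (mp \<psi> \<chi>)
  have "\<phi> \<box>\<rightarrow> ((\<psi> \<^bold>\<longrightarrow> \<chi>) \<^bold>\<and> \<psi>) \<in> w"
    using mp A1[of \<phi> "\<psi> \<^bold>\<longrightarrow> \<chi>" \<psi>] w prime_ICK_mp prime_and_iff
    unfolding ICK_iff_imps boxed_def by blast
  moreover have "ICK ((\<psi> \<^bold>\<longrightarrow> \<chi>) \<^bold>\<and> \<psi> \<^bold>\<longrightarrow> \<chi>)"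
    unfolding ICK_iff_derives derives_imp_iff derives_insert_and
    by (meson derives_assm derives_mp insertCI)
  ultimately show ?case
    unfolding boxed_def using w ICK_box_mono prime_ICK_mp by blast
qed

text \<open>A6 rules out the empty disjunction and A3 splits the others.\<close>

lemma possible_Disj:
  assumes w: "prime_theory w" and "Disj \<delta>s \<in> possible \<phi> w"
  shows "\<exists>\<delta>\<in>set \<delta>s. \<delta> \<in> possible \<phi> w"
  using assms(2)
proof (induction \<delta>s rule: Disj.induct)
  case 1
  then have "\<^bold>\<bottom> \<in> w"
    using prime_ICK_mp[OF w A6] by (simp add: possible_def)
  then show ?case
    using prime_bot[OF w] by blast
next
  case (3 \<delta> \<epsilon> \<epsilon>s)
  have "ICK ((\<phi> \<diamond>\<rightarrow> (\<delta> \<^bold>\<or> Disj (\<epsilon> # \<epsilon>s))) \<^bold>\<longrightarrow> ((\<phi> \<diamond>\<rightarrow> \<delta>) \<^bold>\<or> (\<phi> \<diamond>\<rightarrow> Disj (\<epsilon> # \<epsilon>s))))"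
    using A3 unfolding ICK_iff_imps by blast
  moreover have "\<phi> \<diamond>\<rightarrow> (\<delta> \<^bold>\<or> Disj (\<epsilon> # \<epsilon>s)) \<in> w"
    using "3.prems" by (simp add: possible_def)
  ultimately have "\<delta> \<in> possible \<phi> w \<or> Disj (\<epsilon> # \<epsilon>s) \<in> possible \<phi> w"
    unfolding possible_def mem_Collect_eq using w prime_ICK_mp prime_orD by blast
  then show ?case
    using "3.IH" by (metis list.set_intros)
qed simp

section \<open>Construction of successors and predecessors\<close>

definition canonical_succ :: "fm \<Rightarrow> fm set \<Rightarrow> fm set \<Rightarrow> bool" where
  "canonical_succ \<phi> w v \<longleftrightarrow> boxed \<phi> w \<subseteq> v \<and> v \<subseteq> possible \<phi> w"

text \<open>Extend \<open>S\<close> and \<open>boxed \<phi> w\<close> to a prime theory that avoids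
  everything outside \<open>possible \<phi> w\<close>. The included set gives one half of
  \<open>canonical_succ\<close>, the avoided set the other.\<close>

lemma canonical_succ_exists:
  assumes w: "prime_theory w" and S: "S \<noteq> {}" "S \<subseteq> possible \<phi> w"
    and directed: "\<And>\<alpha> \<beta>. \<alpha> \<in> S \<Longrightarrow> \<beta> \<in> S \<Longrightarrow> \<exists>\<gamma>\<in>S. ICK (\<gamma> \<^bold>\<longrightarrow> \<alpha>) \<and> ICK (\<gamma> \<^bold>\<longrightarrow> \<beta>)"
  obtains v where "prime_theory v" "S \<subseteq> v" "canonical_succ \<phi> w v"
proof -
  have "consistent (S \<union> boxed \<phi> w) (- possible \<phi> w)"
    unfolding consistent_def
  proof
    assume "\<exists>\<delta>s. set \<delta>s \<subseteq> - possible \<phi> w \<and> S \<union> boxed \<phi> w \<turnstile> Disj \<delta>s"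
    then obtain \<delta>s where \<delta>s: "set \<delta>s \<subseteq> - possible \<phi> w" "S \<union> boxed \<phi> w \<turnstile> Disj \<delta>s"
      by blast
    \<comment> \<open>One \<open>\<alpha>\<close> in \<open>S\<close> carries the whole use of
      \<open>S\<close>. It is possible and its implication to the disjunction is boxed, so A2 makes
      the disjunction possible, and then one of its members.\<close>
    obtain \<alpha> where \<alpha>: "\<alpha> \<in> S" "boxed \<phi> w \<turnstile> \<alpha> \<^bold>\<longrightarrow> Disj \<delta>s"
      using derives_directed[OF \<delta>s(2) S(1) directed] by blast
    have "\<phi> \<box>\<rightarrow> (\<alpha> \<^bold>\<longrightarrow> Disj \<delta>s) \<in> w"
      using boxed_closed[OF w \<alpha>(2)] by (simp add: boxed_def)
    moreover have "\<phi> \<diamond>\<rightarrow> \<alpha> \<in> w"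
      using \<alpha>(1) S(2) by (auto simp: possible_def)
    ultimately have "\<phi> \<diamond>\<rightarrow> (\<alpha> \<^bold>\<and> (\<alpha> \<^bold>\<longrightarrow> Disj \<delta>s)) \<in> w"
      using A2 w prime_ICK_mp prime_and_iff by blast
    moreover have "ICK (\<alpha> \<^bold>\<and> (\<alpha> \<^bold>\<longrightarrow> Disj \<delta>s) \<^bold>\<longrightarrow> Disj \<delta>s)"
      unfolding ICK_iff_derives derives_imp_iff derives_insert_and
      by (meson derives_assm derives_mp insertCI)
    ultimately have "Disj \<delta>s \<in> possible \<phi> w"
      using w ICK_dia_mono prime_ICK_mp unfolding possible_def by blast
    then show False
      using possible_Disj[OF w] \<delta>s(1) by blast
  qed
  then obtain v where "prime_theory v" "S \<union> boxed \<phi> w \<subseteq> v" "v \<inter> - possible \<phi> w = {}"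
    by (rule prime_extension)
  then show thesis
    using that unfolding canonical_succ_def by blast
qed

text \<open>Finitely many boxes to be avoided reduce to one: take the disjunction of their
  consequents, which stays outside \<open>v\<close> because \<open>v\<close> is prime. For the empty
  list falsum serves as \<open>\<theta>\<close>.\<close>

lemma Disj_boxes_imp_box:
  assumes v: "prime_theory v" and "set \<delta>s \<subseteq> {\<phi> \<box>\<rightarrow> \<theta> |\<theta>. \<theta> \<notin> v}"
  shows "\<exists>\<theta>. \<theta> \<notin> v \<and> ICK (Disj \<delta>s \<^bold>\<longrightarrow> (\<phi> \<box>\<rightarrow> \<theta>))"
  using assms(2)
proof (induction \<delta>s rule: Disj.induct)
  case 1
  then show ?case
    using A0_Bot prime_bot[OF v] by auto
next
  case (2 \<delta>)
  then show ?case
    using ICK_self_imp by auto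
next
  case (3 \<delta> \<epsilon> \<epsilon>s)
  then obtain \<theta> \<eta> where *: "\<delta> = (\<phi> \<box>\<rightarrow> \<theta>)" "\<theta> \<notin> v" "\<eta> \<notin> v"
    "ICK (Disj (\<epsilon> # \<epsilon>s) \<^bold>\<longrightarrow> (\<phi> \<box>\<rightarrow> \<eta>))"
    by auto
  have "{\<phi> \<box>\<rightarrow> \<theta>} \<turnstile> \<phi> \<box>\<rightarrow> (\<theta> \<^bold>\<or> \<eta>)" "{\<phi> \<box>\<rightarrow> \<eta>} \<turnstile> \<phi> \<box>\<rightarrow> (\<theta> \<^bold>\<or> \<eta>)"
    using ICK_box_mono[OF A0_OrI1] ICK_box_mono[OF A0_OrI2]
    by (simp_all add: ICK_iff_derives derives_imp_iff)
  moreover have "{Disj (\<epsilon> # \<epsilon>s)} \<turnstile> \<phi> \<box>\<rightarrow> \<eta>"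
    using *(4) by (simp only: ICK_iff_derives derives_imp_iff)
  ultimately have "ICK (\<delta> \<^bold>\<or> Disj (\<epsilon> # \<epsilon>s) \<^bold>\<longrightarrow> (\<phi> \<box>\<rightarrow> (\<theta> \<^bold>\<or> \<eta>)))"
    unfolding ICK_iff_derives derives_imp_iff derives_insert_or
    using *(1) derives_cut by (metis singletonD)
  moreover have "\<theta> \<^bold>\<or> \<eta> \<notin> v"
    using *(2,3) prime_orD[OF v] by blast
  ultimately show ?case by auto
qed

text \<open>The prime theory \<open>w'\<close> has to contain
  \<open>\<phi> \<diamond>\<rightarrow> \<chi>\<close> for every \<open>\<chi>\<close> in
  \<open>v\<close> and to omit \<open>\<phi> \<box>\<rightarrow> \<theta>\<close> for every
  \<open>\<theta>\<close> outside \<open>v\<close>. Axiom A4 makes these demands consistent with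
  \<open>w\<close>.\<close>

lemma canonical_pred_exists:
  assumes w: "prime_theory w" and v: "prime_theory v" and sub: "boxed \<phi> w \<subseteq> v"
  obtains w' where "prime_theory w'" "w \<subseteq> w'" "canonical_succ \<phi> w' v"
proof -
  let ?S = "(\<lambda>\<chi>. \<phi> \<diamond>\<rightarrow> \<chi>) ` v"
  let ?D = "{\<phi> \<box>\<rightarrow> \<theta> |\<theta>. \<theta> \<notin> v}"
  have "\<^bold>\<top> \<in> v"
    using A0_Top v prime_ICK by blast
  then have ne: "?S \<noteq> {}" by blast
  \<comment> \<open>Two diamonds with consequents in \<open>v\<close> are both implied by the
    diamond of the conjunction of these consequents.\<close>
  have directed: "\<exists>\<gamma>\<in>?S. ICK (\<gamma> \<^bold>\<longrightarrow> \<alpha>) \<and> ICK (\<gamma> \<^bold>\<longrightarrow> \<beta>)" if \<alpha>\<beta>: "\<alpha> \<in> ?S" "\<beta> \<in> ?S" for \<alpha> \<beta>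
  proof -
    obtain \<psi> \<chi> where *: "\<psi> \<in> v" "\<chi> \<in> v" "\<alpha> = (\<phi> \<diamond>\<rightarrow> \<psi>)" "\<beta> = (\<phi> \<diamond>\<rightarrow> \<chi>)"
      using \<alpha>\<beta> by blast
    then have "\<psi> \<^bold>\<and> \<chi> \<in> v"
      using v by (simp add: prime_and_iff)
    then show ?thesis
      unfolding *(3,4)
      by (intro bexI[of _ "\<phi> \<diamond>\<rightarrow> (\<psi> \<^bold>\<and> \<chi>)"] conjI ICK_dia_mono A0_AndE1 A0_AndE2) simp
  qed
  have "consistent (?S \<union> w) ?D"
    unfolding consistent_def
  proof
    assume "\<exists>\<delta>s. set \<delta>s \<subseteq> ?D \<and> ?S \<union> w \<turnstile> Disj \<delta>s"
    then obtain \<delta>s where \<delta>s: "set \<delta>s \<subseteq> ?D" "?S \<union> w \<turnstile> Disj \<delta>s" by blast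
    have "\<exists>\<alpha>\<in>?S. w \<turnstile> \<alpha> \<^bold>\<longrightarrow> Disj \<delta>s"
      by (rule derives_directed[OF \<delta>s(2) ne]) (rule directed)
    then obtain \<chi> where \<chi>: "\<chi> \<in> v" "w \<turnstile> (\<phi> \<diamond>\<rightarrow> \<chi>) \<^bold>\<longrightarrow> Disj \<delta>s"
      by blast
    obtain \<theta> where \<theta>: "\<theta> \<notin> v" "ICK (Disj \<delta>s \<^bold>\<longrightarrow> (\<phi> \<box>\<rightarrow> \<theta>))"
      using Disj_boxes_imp_box[OF v \<delta>s(1)] by blast
    have "w \<turnstile> (\<phi> \<diamond>\<rightarrow> \<chi>) \<^bold>\<longrightarrow> (\<phi> \<box>\<rightarrow> \<theta>)"
      using \<chi>(2) by (rule derives_imp_trans) (rule derives_ICK[OF \<theta>(2)])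
    then have "\<phi> \<box>\<rightarrow> (\<chi> \<^bold>\<longrightarrow> \<theta>) \<in> w"
      by (intro prime_closed[OF w] derives_mp[OF derives_ICK[OF A4]])
    then have "\<chi> \<^bold>\<longrightarrow> \<theta> \<in> v"
      using sub by (auto simp: boxed_def)
    then show False
      using \<chi>(1) \<theta>(1) v prime_mp by blast
  qed
  then obtain w' where w': "prime_theory w'" "?S \<union> w \<subseteq> w'" "w' \<inter> ?D = {}"
    by (rule prime_extension)
  have "\<psi> \<in> v" if "\<phi> \<box>\<rightarrow> \<psi> \<in> w'" for \<psi>
    using that w'(3) by auto
  then have "canonical_succ \<phi> w' v"
    using w'(2) by (auto simp: canonical_succ_def boxed_def possible_def)
  then show thesis
    using that w'(1,2) by simp
qed

section \<open>Invariance under equivalent antecedents\<close>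

lemma boxed_cong: "prime_theory w \<Longrightarrow> ICK (\<phi> \<^bold>\<longleftrightarrow> \<psi>) \<Longrightarrow> boxed \<phi> w = boxed \<psi> w"
  using RA_Box prime_ICK_mp unfolding ICK_iff_imps boxed_def by blast

lemma possible_cong: "prime_theory w \<Longrightarrow> ICK (\<phi> \<^bold>\<longleftrightarrow> \<psi>) \<Longrightarrow> possible \<phi> w = possible \<psi> w"
  using RA_Dia prime_ICK_mp unfolding ICK_iff_imps possible_def by blast

section \<open>The canonical model\<close>

text \<open>For a set \<open>X\<close> that is not a proof set the relation is empty, so (c1) and
  (c2) hold vacuously there.\<close>

definition canonical :: "fm set chellas" where
  "canonical = \<lparr>worlds = Collect prime_theory,
     le = {(w, v). prime_theory w \<and> prime_theory v \<and> w \<subseteq> v},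
     rel = {(w, X, v). prime_theory w \<and> prime_theory v \<and>
              (\<exists>\<phi>. X = proof_set \<phi> \<and> canonical_succ \<phi> w v)},
     val = (\<lambda>p. proof_set (Var p))\<rparr>"

text \<open>The existential over formulas in \<open>rel\<close> may be instantiated by any formula
  with the given proof set: such formulas are provably equivalent, and the congruence rules for
  antecedents make their successors agree.\<close>

lemma canonical_rel_iff:
  "(w, proof_set \<phi>, v) \<in> rel canonical \<longleftrightarrow>
     prime_theory w \<and> prime_theory v \<and> canonical_succ \<phi> w v"
proof -
  have "canonical_succ \<psi> w v \<longleftrightarrow> canonical_succ \<phi> w v"
    if "prime_theory w" "proof_set \<phi> = proof_set \<psi>" for \<psi>
  proof -
    have "ICK (\<phi> \<^bold>\<longleftrightarrow> \<psi>)"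
      using that(2) proof_set_subset_imp by (simp add: ICK_iff_imps)
    then show ?thesis
      using boxed_cong possible_cong that(1) unfolding canonical_succ_def by simp
  qed
  then show ?thesis
    unfolding canonical_def by auto
qed

lemma canonical_worlds: "worlds canonical = Collect prime_theory"
  and canonical_le_iff: "(w, v) \<in> le canonical \<longleftrightarrow> prime_theory w \<and> prime_theory v \<and> w \<subseteq> v"
  and canonical_val: "val canonical p = proof_set (Var p)"
  unfolding canonical_def by simp_all

lemma canonical_relE:
  assumes "(w, X, v) \<in> rel canonical"
  obtains \<phi> where "X = proof_set \<phi>" "prime_theory w" "prime_theory v" "canonical_succ \<phi> w v"
  using assms unfolding canonical_def by auto

section \<open>Soundness\<close>

context chellas_model
begin

lemma le_refl: "w \<in> worlds M \<Longrightarrow> (w, w) \<in> le M"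
  and le_trans: "(u, v) \<in> le M \<Longrightarrow> (v, w) \<in> le M \<Longrightarrow> (u, w) \<in> le M"
  and le_worlds: "(v, w) \<in> le M \<Longrightarrow> v \<in> worlds M \<and> w \<in> worlds M"
  using le_preorder unfolding preorder_on_def refl_on_def trans_def by blast+

lemma rel_worlds: "(w, X, v) \<in> rel M \<Longrightarrow> v \<in> worlds M"
  using rel_subset by blast

text \<open>Implication and box quantify over all larger worlds, so transitivity suffices for them.
  The diamond is evaluated at the world itself and needs (c1).\<close>

lemma sat_upward: "sat M w \<phi> \<Longrightarrow> (w, v) \<in> le M \<Longrightarrow> sat M v \<phi>"
proof (induction \<phi> arbitrary: w v)
  case (CDia \<psi> \<chi>)
  let ?X = "{x \<in> worlds M. sat M x \<psi>}"
  obtain u where "(w, ?X, u) \<in> rel M" "sat M u \<chi>"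
    using CDia.prems(1) by auto
  moreover from this(1) obtain u' where "(v, ?X, u') \<in> rel M" "(u, u') \<in> le M"
    using c1[of ?X w v u] CDia.prems(2) by auto
  ultimately show ?case
    using CDia.IH(2) by auto
next
  case (Imp \<psi> \<chi>)
  then show ?case by (auto intro: le_trans)
next
  case (CBox \<psi> \<chi>)
  then show ?case by (auto intro: le_trans)
qed (auto intro: val_upward)

lemma ICK_sound: "ICK \<phi> \<Longrightarrow> w \<in> worlds M \<Longrightarrow> sat M w \<phi>"
proof (induction arbitrary: w rule: ICK.induct)
  case (A0_K \<phi> \<psi>)
  then show ?case by (auto intro: sat_upward)
next
  case (A0_S \<phi> \<psi> \<chi>)
  then show ?case by (auto) (meson le_trans le_refl le_worlds)
next
  case (A0_AndI \<phi> \<psi>)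
  then show ?case by (auto intro: sat_upward)
next
  case (A0_OrE \<phi> \<chi> \<psi>)
  then show ?case by (auto) (meson le_trans)+
next
  case (A1 \<phi> \<psi> \<chi>)
  then show ?case by auto
next
  case (A2 \<phi> \<psi> \<chi>)
  then show ?case by (auto) (meson le_refl le_worlds)
next
  case (A4 \<phi> \<psi> \<chi>)
  let ?X = "{x \<in> worlds M. sat M x \<phi>}"
  show ?case
    unfolding sat.simps(6,7)
  proof (intro allI impI)
    fix x v u u'
    assume x: "\<forall>v. (x, v) \<in> le M \<longrightarrow> sat M v (\<phi> \<diamond>\<rightarrow> \<psi>) \<longrightarrow>
        (\<forall>va u. (v, va) \<in> le M \<longrightarrow> (va, ?X, u) \<in> rel M \<longrightarrow> sat M u \<chi>)"
      and v: "(x, v) \<in> le M" "(v, ?X, u) \<in> rel M" "(u, u') \<in> le M" "sat M u' \<psi>"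
    \<comment> \<open>By (c2), \<open>u'\<close> is itself a successor of some \<open>v'\<close>
      above \<open>v\<close>. There \<open>u'\<close> witnesses the diamond, so the assumed
      implication yields the box at \<open>v'\<close>, which applies to \<open>u'\<close>.\<close>
    obtain v' where v': "(v, v') \<in> le M" "(v', ?X, u') \<in> rel M"
      using c2[of ?X v u u'] v by auto
    have "sat M v' (\<phi> \<diamond>\<rightarrow> \<psi>)"
      using v' v(4) by auto
    then show "sat M u' \<chi>"
      using x v(1) v' le_trans le_refl le_worlds by blast
  qed
next
  case (MP \<phi> \<psi>)
  then show ?case using le_refl by simp
next
  case (RA_Box \<phi> \<psi> \<chi>)
  \<comment> \<open>Accessibility depends on the antecedent only through its truth set.\<close>
  then have "{x \<in> worlds M. sat M x \<phi>} = {x \<in> worlds M. sat M x \<psi>}"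
    using le_refl by auto
  then show ?case by simp
next
  case (RC_Box \<phi> \<psi> \<chi>)
  then have "sat M x \<phi> \<longleftrightarrow> sat M x \<psi>" if "x \<in> worlds M" for x
    using le_refl that by auto
  then show ?case using rel_worlds by auto
next
  case (RA_Dia \<phi> \<psi> \<chi>)
  then have "{x \<in> worlds M. sat M x \<phi>} = {x \<in> worlds M. sat M x \<psi>}"
    using le_refl by auto
  then show ?case by simp
next
  case (RC_Dia \<phi> \<psi> \<chi>)
  then have "sat M x \<phi> \<longleftrightarrow> sat M x \<psi>" if "x \<in> worlds M" for x
    using le_refl that by auto
  then show ?case using rel_worlds by auto
qed auto

lemma derives_sound:
  assumes "\<Gamma> \<turnstile> \<psi>" and "w \<in> worlds M" and "\<And>\<phi>. \<phi> \<in> \<Gamma> \<Longrightarrow> sat M w \<phi>"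
  shows "sat M w \<psi>"
  using assms(1)
proof (induction rule: derives_induct)
  case (mp \<phi> \<chi>)
  then show ?case using le_refl[OF assms(2)] by auto
qed (use assms ICK_sound in auto)

lemma sat_Disj: "sat M w (Disj \<delta>s) \<longleftrightarrow> (\<exists>\<delta>\<in>set \<delta>s. sat M w \<delta>)"
  by (induction \<delta>s rule: Disj.induct) auto

end

text \<open>A derivable disjunction from \<open>\<Delta>\<close> would be true at the satisfying
  world, and with it some member of \<open>\<Delta>\<close>. The type of worlds is
  arbitrary.\<close>

lemma satisfiable_imp_consistent:
  assumes "satisfiable TYPE('w) \<Gamma> \<Delta>"
  shows "consistent \<Gamma> \<Delta>"
proof -
  obtain M :: "'w chellas" and w where "chellas_model M" and w: "w \<in> worlds M"
    "\<forall>\<phi>\<in>\<Gamma>. sat M w \<phi>" "\<forall>\<phi>\<in>\<Delta>. \<not> sat M w \<phi>"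
    using assms unfolding satisfiable_def by blast
  interpret chellas_model M by fact
  have False if "set \<delta>s \<subseteq> \<Delta>" "\<Gamma> \<turnstile> Disj \<delta>s" for \<delta>s
  proof -
    have "sat M w (Disj \<delta>s)"
      using that(2) w(1,2) derives_sound by simp
    then show False
      using w(3) that(1) by (auto simp: sat_Disj)
  qed
  then show ?thesis
    unfolding consistent_def by blast
qed

lemma ICK_imp_IntCK: "ICK \<phi> \<Longrightarrow> \<phi> \<in> IntCK TYPE('w)"
  unfolding IntCK_def by (simp add: chellas_model.ICK_sound)

section \<open>Completeness\<close>

text \<open>The given \<open>T\<close> shows that there are worlds at all; (c1) and (c2) come from
  the constructions of successors and predecessors.\<close>

lemma canonical_model:
  assumes "prime_theory T"
  shows "chellas_model canonical"
proof
  show "worlds canonical \<noteq> {}"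
    using assms by (auto simp: canonical_worlds)
  show "preorder_on (worlds canonical) (le canonical)"
    by (auto simp: preorder_on_def refl_on_def trans_def canonical_worlds canonical_def)
  show "rel canonical \<subseteq> worlds canonical \<times> Pow (worlds canonical) \<times> worlds canonical"
    by (auto simp: canonical_def proof_set_def)
  show "val canonical p \<subseteq> worlds canonical" for p
    by (auto simp: canonical_val canonical_worlds proof_set_def)
  show "v \<in> val canonical p" if "w \<in> val canonical p" "(w, v) \<in> le canonical" for w v p
    using that by (auto simp: canonical_val canonical_le_iff proof_set_def)
next
  fix X w w' v
  assume w': "(w, w') \<in> le canonical" and "(w, X, v) \<in> rel canonical"
  then obtain \<phi> where X: "X = proof_set \<phi>" and v: "prime_theory v" "canonical_succ \<phi> w v"
    by (blast elim: canonical_relE)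
  have pw': "prime_theory w'" "w \<subseteq> w'"
    using w' by (simp_all add: canonical_le_iff)
  have "\<^bold>\<top> \<in> v"
    using v(1) A0_Top prime_ICK by blast
  then have ne: "v \<noteq> {}" by blast
  \<comment> \<open>For (c1): \<open>possible\<close> grows with the world, and \<open>v\<close> is
    directed by its conjunctions, so \<open>v\<close> extends to a successor of
    \<open>w'\<close>.\<close>
  have sub: "v \<subseteq> possible \<phi> w'"
    using v(2) pw'(2) by (auto simp: canonical_succ_def possible_def)
  have "\<exists>\<gamma>\<in>v. ICK (\<gamma> \<^bold>\<longrightarrow> \<alpha>) \<and> ICK (\<gamma> \<^bold>\<longrightarrow> \<beta>)" if "\<alpha> \<in> v" "\<beta> \<in> v" for \<alpha> \<beta>
    using that v(1) by (intro bexI[of _ "\<alpha> \<^bold>\<and> \<beta>"] conjI A0_AndE1 A0_AndE2) (simp add: prime_and_iff)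
  then obtain v' where "prime_theory v'" "v \<subseteq> v'" "canonical_succ \<phi> w' v'"
    by (rule canonical_succ_exists[OF pw'(1) ne sub])
  then show "\<exists>v'. (w', X, v') \<in> rel canonical \<and> (v, v') \<in> le canonical"
    unfolding X canonical_rel_iff canonical_le_iff using pw' v(1) by blast
next
  fix X w v v'
  assume v': "(v, v') \<in> le canonical" and "(w, X, v) \<in> rel canonical"
  then obtain \<phi> where X: "X = proof_set \<phi>" and w: "prime_theory w" "canonical_succ \<phi> w v"
    by (blast elim: canonical_relE)
  \<comment> \<open>For (c2): enlarging \<open>v\<close> keeps the boxed half of the successor
    condition, which is all that the predecessor construction asks for.\<close>
  have pv': "prime_theory v'" "boxed \<phi> w \<subseteq> v'"
    using v' w(2) by (auto simp: canonical_le_iff canonical_succ_def)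
  obtain w' where "prime_theory w'" "w \<subseteq> w'" "canonical_succ \<phi> w' v'"
    using canonical_pred_exists[OF w(1) pv'] .
  then show "\<exists>w'. (w, w') \<in> le canonical \<and> (w', X, v') \<in> rel canonical"
    unfolding X canonical_rel_iff canonical_le_iff using w(1) pv'(1) by (intro exI[of _ w']) simp
qed

text \<open>If \<open>\<psi>\<close> does not follow from \<open>boxed \<phi> w\<close>, some prime
  \<open>u\<close> containing that set omits it. In general \<open>u\<close> is a successor only of
  some \<open>v\<close> above \<open>w\<close>, which is what the box clause quantifies
  over.\<close>

lemma prime_box_iff:
  assumes w: "prime_theory w"
  shows "\<phi> \<box>\<rightarrow> \<psi> \<in> w \<longleftrightarrow>
    (\<forall>v u. prime_theory v \<longrightarrow> w \<subseteq> v \<longrightarrow> prime_theory u \<longrightarrow> canonical_succ \<phi> v u \<longrightarrow> \<psi> \<in> u)"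
proof
  assume R: "\<forall>v u. prime_theory v \<longrightarrow> w \<subseteq> v \<longrightarrow> prime_theory u \<longrightarrow> canonical_succ \<phi> v u \<longrightarrow> \<psi> \<in> u"
  have "boxed \<phi> w \<turnstile> \<psi>"
  proof (rule ccontr)
    assume "\<not> boxed \<phi> w \<turnstile> \<psi>"
    then obtain u where u: "prime_theory u" "boxed \<phi> w \<subseteq> u" "\<psi> \<notin> u"
      by (rule prime_separation)
    obtain v where "prime_theory v" "w \<subseteq> v" "canonical_succ \<phi> v u"
      using canonical_pred_exists[OF w u(1,2)] .
    then show False
      using R u by blast
  qed
  then show "\<phi> \<box>\<rightarrow> \<psi> \<in> w"
    using boxed_closed[OF w] by (simp add: boxed_def)
qed (auto simp: canonical_succ_def boxed_def)

text \<open>A singleton is directed, so the successor construction applies to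
  \<open>{\<psi>}\<close> at \<open>w\<close> itself.\<close>

lemma prime_dia_iff:
  assumes w: "prime_theory w"
  shows "\<phi> \<diamond>\<rightarrow> \<psi> \<in> w \<longleftrightarrow> (\<exists>u. prime_theory u \<and> canonical_succ \<phi> w u \<and> \<psi> \<in> u)"
proof
  assume "\<phi> \<diamond>\<rightarrow> \<psi> \<in> w"
  then have "{\<psi>} \<subseteq> possible \<phi> w"
    by (simp add: possible_def)
  then obtain u where "prime_theory u" "{\<psi>} \<subseteq> u" "canonical_succ \<phi> w u"
    using canonical_succ_exists[OF w, of "{\<psi>}"] ICK_self_imp by auto
  then show "\<exists>u. prime_theory u \<and> canonical_succ \<phi> w u \<and> \<psi> \<in> u"
    by blast
qed (auto simp: canonical_succ_def possible_def)

lemma truth_lemma: "prime_theory w \<Longrightarrow> sat canonical w \<phi> \<longleftrightarrow> \<phi> \<in> w"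
proof (induction \<phi> arbitrary: w)
  case (Imp \<phi> \<psi>)
  then show ?case
    by (auto simp: canonical_le_iff prime_imp_iff[OF Imp.prems])
next
  case (CBox \<phi> \<psi>)
  \<comment> \<open>The induction hypothesis for the antecedent turns its truth set into a proof
    set, the only kind of index with a nonempty canonical relation.\<close>
  have X: "{x \<in> worlds canonical. sat canonical x \<phi>} = proof_set \<phi>"
    using CBox.IH(1) by (auto simp: canonical_worlds proof_set_def)
  show ?case
    unfolding sat.simps X canonical_le_iff canonical_rel_iff prime_box_iff[OF CBox.prems]
    using CBox.IH(2) CBox.prems by auto
next
  case (CDia \<phi> \<psi>)
  have X: "{x \<in> worlds canonical. sat canonical x \<phi>} = proof_set \<phi>"
    using CDia.IH(1) by (auto simp: canonical_worlds proof_set_def)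
  show ?case
    unfolding sat.simps X canonical_rel_iff prime_dia_iff[OF CDia.prems]
    using CDia.IH(2) CDia.prems by auto
qed (auto simp: canonical_val proof_set_def prime_and_iff prime_or_iff prime_bot
    intro: prime_ICK A0_Top)

lemma consistent_imp_satisfiable:
  assumes "consistent \<Gamma> \<Delta>"
  shows "satisfiable TYPE(fm set) \<Gamma> \<Delta>"
proof -
  obtain T where T: "prime_theory T" "\<Gamma> \<subseteq> T" "T \<inter> \<Delta> = {}"
    using prime_extension[OF assms] .
  then have "T \<in> worlds canonical" "\<forall>\<phi>\<in>\<Gamma>. sat canonical T \<phi>" "\<forall>\<phi>\<in>\<Delta>. \<not> sat canonical T \<phi>"
    by (auto simp: canonical_worlds truth_lemma)
  then show ?thesis
    unfolding satisfiable_def using canonical_model[OF T(1)] by blast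
qed

lemma IntCK_imp_ICK:
  assumes "\<phi> \<in> IntCK TYPE(fm set)"
  shows "ICK \<phi>"
proof (rule ccontr)
  assume "\<not> ICK \<phi>"
  then have "satisfiable TYPE(fm set) {} {\<phi>}"
    by (simp add: ICK_iff_derives consistent_imp_satisfiable consistent_single_iff)
  then show False
    using assms unfolding satisfiable_def IntCK_def by blast
qed

text \<open>The type \<open>fm set\<close> of the canonical worlds suffices for completeness, while
  soundness holds for worlds of any type \<open>'w\<close>. Together they show that the choice of
  \<open>fm set\<close> does not restrict the semantic notions.\<close>

theorem theorem1:
  fixes \<Gamma> \<Delta> :: "fm set" and \<phi> :: fm
  shows "(consistent \<Gamma> \<Delta> \<longleftrightarrow> satisfiable TYPE(fm set) \<Gamma> \<Delta>) \<and>
         (satisfiable TYPE('w) \<Gamma> \<Delta> \<longrightarrow> consistent \<Gamma> \<Delta>) \<and>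
         (ICK \<phi> \<longleftrightarrow> \<phi> \<in> IntCK TYPE(fm set)) \<and>
         (ICK \<phi> \<longrightarrow> \<phi> \<in> IntCK TYPE('w))"
  by (intro conjI impI iffI)
    (erule consistent_imp_satisfiable satisfiable_imp_consistent IntCK_imp_ICK ICK_imp_IntCK)+

end
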